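(* Let $R$ be a finite ring with identity $1\neq 0$. Then $$Cl_2(R)\cong Shu^{|U'(R)|}_{|U(R)|}(I(R)).$$
   Context: Rings need not be commutative. $Id(R)$ is the set of idempotents of $R$, $U(R)$ the set of units, and $U'(R)=\{u\in U(R):u^2=1\}$. The idempotent graph $I(R)$ is the simple undirected graph whose vertices are the nontrivial idempotents of $R$ (those different from $0$ and $1$), where two distinct vertices $x,y$ are adjacent if and only if $xy=yx=0$ (it may have empty vertex set). $Cl_2(R)$ is the simple undirected graph with vertex set $\{(e,u): e\in Id(R)\setminus\{0\},\ u\in U(R)\}$, in which two distinct vertices $(e,u)$ and $(f,v)$ are adjacent if and only if $ef=fe=0$ or $uv=vu=1$. The $(t,n)$-shuriken graph: let $G$ be a simple graph (possibly with no vertices) and let $n,t$ be positive integers with $n-t$ even ($t\le n$ in all uses here). Add a new vertex $z\notin V(G)$ to $G$ and take $n$ copies of the resulting graph; $G'_i$ is the $i$-th copy, with vertex set $V(G'_i)=\{z_i\}\cup\{v_i: v\in V(G)\}$. Then $Shu^t_n(G)$ is the simple graph with vertex set $\bigcup_{i=1}^n V(G'_i)$ and edge set $$\{u_iv_j: uv\in E(G),\ i,j\in\{1,\dots,n\}\}\cup\{u_iv_i: u_i,v_i\in V(G'_i),\ u_i\ne v_i,\ i\in\{1,\dots,t\}\}\cup\left\{u_iv_{n+t+1-i}: u_i\in V(G'_i),\ v_{n+t+1-i}\in V(G'_{n+t+1-i}),\ i\in\{t+1,\dots,\tfrac{n+t}{2}\}\right\},$$ where in the last two sets $u$ and $v$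 range over $V(G)\cup\{z\}$ (with $u=v$ allowed in the last set). *)

theory Defs
  imports
    "HOL-Algebra.Ring"
    "Graph_Theory.Pair_Digraph"
    "Graph_Theory.Digraph_Isomorphism"
begin

text \<open>
  A simple undirected graph is a \<^locale>\<open>pair_graph\<close>: an edge joining \<open>x\<close> and \<open>y\<close> is represented by
  the two arcs \<open>(x, y)\<close> and \<open>(y, x)\<close>. For such graphs \<open>digraph_iso\<close> is isomorphism of simple graphs.
\<close>

lemma digraph_iso_with_proj_iff:
  assumes "pair_wf_digraph G" and "pair_wf_digraph H"
  shows "digraph_iso (with_proj G) (with_proj H) \<longleftrightarrow>
    (\<exists>f. bij_betw f (pverts G) (pverts H) \<and>
      (\<forall>x \<in> pverts G. \<forall>y \<in> pverts G. (x, y) \<in> parcs G \<longleftrightarrow> (f x, f y) \<in> parcs H))"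
    (is "?L \<longleftrightarrow> ?R")
proof
  interpret G: pair_wf_digraph G by fact
  assume ?L
  then obtain h where h: "pre_digraph.digraph_isomorphism (with_proj G) h"
    and H: "with_proj H = app_iso h (with_proj G)"
    unfolding digraph_iso_def by blast
  let ?f = "iso_verts h"
  have V: "pverts H = ?f ` pverts G" and A: "parcs H = iso_arcs h ` parcs G"
    and ends: "iso_tail h = fst" "iso_head h = snd"
    using H by (simp_all add: with_proj_def app_iso_def)
  have inj: "inj_on ?f (pverts G)"
    using h by (simp add: pre_digraph.digraph_isomorphism_def)
  have "iso_arcs h a = (?f (fst a), ?f (snd a))" if "a \<in> parcs G" for a
    using h that by (simp add: pre_digraph.digraph_isomorphism_def ends prod_eq_iff)
  then have A': "parcs H = (\<lambda>a. (?f (fst a), ?f (snd a))) ` parcs G"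
    using A by simp
  have "(x, y) \<in> parcs G" if "x \<in> pverts G" "y \<in> pverts G" "(?f x, ?f y) \<in> parcs H" for x y
  proof -
    obtain a b where "(a, b) \<in> parcs G" "?f x = ?f a" "?f y = ?f b"
      using \<open>(?f x, ?f y) \<in> parcs H\<close> unfolding A' by auto
    then show ?thesis
      using inj that G.in_arcsD1 G.in_arcsD2 by (metis inj_onD)
  qed
  moreover have "(?f x, ?f y) \<in> parcs H" if "(x, y) \<in> parcs G" for x y
    using that unfolding A' by force
  ultimately show ?R
    using inj V by (intro exI[of _ ?f]) (auto simp: bij_betw_def)
next
  interpret G: pair_wf_digraph G by fact
  interpret H: pair_wf_digraph H by fact
  assume ?R
  then obtain f where f: "inj_on f (pverts G)" "f ` pverts G = pverts H"
    and adj: "\<And>x y. x \<in> pverts G \<Longrightarrow> y \<in> pverts G \<Longrightarrow> (x, y) \<in> parcs G \<longleftrightarrow> (f x, f y) \<in> parcs H"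
    unfolding bij_betw_def by blast
  let ?h = "\<lparr>iso_verts = f, iso_arcs = map_prod f f, iso_head = snd, iso_tail = fst\<rparr>"
  have "inj_on (map_prod f f) (parcs G)"
    by (rule inj_on_subset[OF map_prod_inj_on[OF f(1) f(1)]]) (auto dest: G.in_arcsD1 G.in_arcsD2)
  then have "pre_digraph.digraph_isomorphism (with_proj G) ?h"
    using f(1) G.wf_digraph by (simp add: pre_digraph.digraph_isomorphism_def)
  moreover have "parcs H = map_prod f f ` parcs G"
  proof (intro subset_antisym subrelI)
    fix x y assume xy: "(x, y) \<in> parcs H"
    then obtain a b where ab: "a \<in> pverts G" "b \<in> pverts G" "x = f a" "y = f b"
      using f(2) H.in_arcsD1[OF xy] H.in_arcsD2[OF xy] by (metis imageE)
    then show "(x, y) \<in> map_prod f f ` parcs G"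
      using xy adj[OF ab(1,2)] by (intro image_eqI[of _ _ "(a, b)"]) simp_all
  next
    fix x y assume "(x, y) \<in> map_prod f f ` parcs G"
    then obtain a b where ab: "(a, b) \<in> parcs G" "x = f a" "y = f b"
      by auto
    then show "(x, y) \<in> parcs H"
      using adj[OF G.in_arcsD1[OF ab(1)] G.in_arcsD2[OF ab(1)]] by simp
  qed
  then have "with_proj H = app_iso ?h (with_proj G)"
    using f(2) by (simp add: with_proj_def app_iso_def)
  ultimately show ?L
    unfolding digraph_iso_def by blast
qed

definition idempotents :: "('a, 'b) ring_scheme \<Rightarrow> 'a set"
  where "idempotents R = {e \<in> carrier R. e \<otimes>\<^bsub>R\<^esub> e = e}"

definition involutive_units :: "('a, 'b) ring_scheme \<Rightarrow> 'a set"
  where "involutive_units R = {u \<in> Units R. u \<otimes>\<^bsub>R\<^esub> u = \<one>\<^bsub>R\<^esub>}"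

definition idempotent_graph :: "('a, 'b) ring_scheme \<Rightarrow> 'a pair_pre_digraph"
  where "idempotent_graph R =
    \<lparr> pverts = idempotents R - {\<zero>\<^bsub>R\<^esub>, \<one>\<^bsub>R\<^esub>},
      parcs = {(x, y). x \<in> idempotents R - {\<zero>\<^bsub>R\<^esub>, \<one>\<^bsub>R\<^esub>} \<and> y \<in> idempotents R - {\<zero>\<^bsub>R\<^esub>, \<one>\<^bsub>R\<^esub>} \<and>
        x \<noteq> y \<and> x \<otimes>\<^bsub>R\<^esub> y = \<zero>\<^bsub>R\<^esub> \<and> y \<otimes>\<^bsub>R\<^esub> x = \<zero>\<^bsub>R\<^esub>} \<rparr>"

definition clean_graph2 :: "('a, 'b) ring_scheme \<Rightarrow> ('a \<times> 'a) pair_pre_digraph"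
  where "clean_graph2 R =
    \<lparr> pverts = (idempotents R - {\<zero>\<^bsub>R\<^esub>}) \<times> Units R,
      parcs = {((e, u), (f, v)).
        (e, u) \<in> (idempotents R - {\<zero>\<^bsub>R\<^esub>}) \<times> Units R \<and>
        (f, v) \<in> (idempotents R - {\<zero>\<^bsub>R\<^esub>}) \<times> Units R \<and>
        (e, u) \<noteq> (f, v) \<and>
        (e \<otimes>\<^bsub>R\<^esub> f = \<zero>\<^bsub>R\<^esub> \<and> f \<otimes>\<^bsub>R\<^esub> e = \<zero>\<^bsub>R\<^esub> \<or>
         u \<otimes>\<^bsub>R\<^esub> v = \<one>\<^bsub>R\<^esub> \<and> v \<otimes>\<^bsub>R\<^esub> u = \<one>\<^bsub>R\<^esub>)} \<rparr>"

text \<open>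
  The new vertex \<open>z\<close> is \<^const>\<open>None\<close>, and the pair \<open>(u, i)\<close> is the vertex \<open>u\<^sub>i\<close> of the \<open>i\<close>-th copy.
  In the third set of arcs each edge occurs in one direction only; \<^const>\<open>mk_symmetric\<close> adds
  the reverse arcs. The definition is meant for \<open>1 \<le> t \<le> n\<close> with \<open>n - t\<close> even.
\<close>

definition shuriken_graph :: "nat \<Rightarrow> nat \<Rightarrow> 'a pair_pre_digraph \<Rightarrow> ('a option \<times> nat) pair_pre_digraph"
  where "shuriken_graph t n G = (let V = insert None (Some ` pverts G) in
    mk_symmetric (with_proj
      \<lparr> pverts = V \<times> {1..n},
        parcs =
          {((Some u, i), (Some v, j)) | u v i j. (u, v) \<in> parcs G \<and> i \<in> {1..n} \<and> j \<in> {1..n}} \<union>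
          {((u, i), (v, i)) | u v i. u \<in> V \<and> v \<in> V \<and> u \<noteq> v \<and> i \<in> {1..t}} \<union>
          {((u, i), (v, n + t + 1 - i)) | u v i. u \<in> V \<and> v \<in> V \<and> i \<in> {t + 1..(n + t) div 2}} \<rparr>))"

lemma pair_graph_idempotent_graph:
  assumes "finite (carrier R)"
  shows "pair_graph (idempotent_graph R)"
proof -
  let ?V = "idempotents R - {\<zero>\<^bsub>R\<^esub>, \<one>\<^bsub>R\<^esub>}"
  have fin: "finite ?V"
    using assms by (simp add: idempotents_def)
  have "parcs (idempotent_graph R) \<subseteq> ?V \<times> ?V"
    by (auto simp: idempotent_graph_def)
  then have "finite (parcs (idempotent_graph R))"
    using fin by (meson finite_SigmaI finite_subset)
  then show ?thesis
    using fin by unfold_locales (auto simp: idempotent_graph_def symmetric_def intro!: symI)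
qed

lemma pair_graph_clean_graph2:
  assumes "finite (carrier R)"
  shows "pair_graph (clean_graph2 R)"
proof -
  let ?V = "(idempotents R - {\<zero>\<^bsub>R\<^esub>}) \<times> Units R"
  have fin: "finite ?V"
    using assms by (simp add: idempotents_def Units_def)
  have "parcs (clean_graph2 R) \<subseteq> ?V \<times> ?V"
    by (auto simp: clean_graph2_def)
  then have "finite (parcs (clean_graph2 R))"
    using fin by (meson finite_SigmaI finite_subset)
  then show ?thesis
    using fin by unfold_locales (auto simp: clean_graph2_def symmetric_def intro!: symI)
qed

lemma pair_graph_shuriken_graph:
  assumes "pair_graph G" and "t \<le> n"
  shows "pair_graph (shuriken_graph t n G)"
proof -
  interpret G: pair_graph G by fact
  let ?V = "insert None (Some ` pverts G) \<times> {1..n}"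
  have fin: "finite ?V"
    by (simp add: G.pair_finite_verts)
  have verts: "pverts (shuriken_graph t n G) = ?V"
    by (simp add: shuriken_graph_def Let_def mk_symmetric_def)
  have sub: "parcs (shuriken_graph t n G) \<subseteq> ?V \<times> ?V"
    using assms(2)
    by (auto simp: shuriken_graph_def Let_def mk_symmetric_def dest: G.in_arcsD1 G.in_arcsD2)
  then have "finite (parcs (shuriken_graph t n G))"
    using fin by (meson finite_SigmaI finite_subset)
  moreover have "symmetric (with_proj (shuriken_graph t n G))"
    unfolding shuriken_graph_def Let_def by (rule symmetric_mk_symmetric)
  moreover have "fst e \<noteq> snd e" if "e \<in> parcs (shuriken_graph t n G)" for e
    using that by (auto simp: shuriken_graph_def Let_def mk_symmetric_def dest: G.no_loops')
  ultimately show ?thesis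
    using fin sub by unfold_locales (auto simp: verts)
qed

text \<open>
  The parameters \<open>|U'(R)|\<close> and \<open>|U(R)|\<close> are admissible for the shuriken graph: inversion pairs off
  the units outside \<open>U'(R)\<close>.
\<close>

lemma even_card_fixpoint_free_involution:
  assumes "finite A"
    and "\<And>x. x \<in> A \<Longrightarrow> f x \<in> A" "\<And>x. x \<in> A \<Longrightarrow> f (f x) = x" "\<And>x. x \<in> A \<Longrightarrow> f x \<noteq> x"
  shows "even (card A)"
  using assms
proof (induction "card A" arbitrary: A rule: less_induct)
  case less
  show ?case
  proof (cases "A = {}")
    case False
    then obtain a where a: "a \<in> A" by blast
    let ?B = "A - {a, f a}"
    have sub: "{a, f a} \<subseteq> A" and two: "card {a, f a} = 2"
      using a less.prems(2)[OF a] less.prems(4)[OF a] by (auto simp: card_2_iff)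
    have card: "card A = card ?B + 2"
      using card_Diff_subset[of "{a, f a}" A] card_mono[OF less.prems(1) sub] two sub by simp
    have "even (card ?B)"
    proof (rule less.hyps)
      fix x assume x: "x \<in> ?B"
      show "f x \<in> ?B"
        using x a less.prems(2,3) by (metis DiffD1 DiffD2 DiffI insert_iff singletonD)
    qed (use card less.prems in auto)
    then show ?thesis using card by simp
  qed simp
qed

lemma card_units_parameters:
  assumes "ring R" and "finite (carrier R)"
  shows "1 \<le> card (involutive_units R)"
    and "card (involutive_units R) \<le> card (Units R)"
    and "even (card (Units R) - card (involutive_units R))"
proof -
  interpret ring R by fact
  have fin: "finite (Units R)"
    using assms(2) by (simp add: Units_def)
  have sub: "involutive_units R \<subseteq> Units R"
    by (auto simp: involutive_units_def)
  have "\<one>\<^bsub>R\<^esub> \<in> involutive_units R"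
    by (simp add: involutive_units_def)
  then show "1 \<le> card (involutive_units R)"
    using finite_subset[OF sub fin] card_gt_0_iff[of "involutive_units R"] by (auto simp: Suc_le_eq)
  show "card (involutive_units R) \<le> card (Units R)"
    using sub fin by (rule card_mono[rotated])
  have "even (card (Units R - involutive_units R))"
  proof (rule even_card_fixpoint_free_involution[where f = "\<lambda>u. inv\<^bsub>R\<^esub> u"])
    fix u assume "u \<in> Units R - involutive_units R"
    then have u: "u \<in> Units R" and ne: "u \<otimes>\<^bsub>R\<^esub> u \<noteq> \<one>\<^bsub>R\<^esub>"
      by (auto simp: involutive_units_def)
    show inv2: "inv\<^bsub>R\<^esub> (inv\<^bsub>R\<^esub> u) = u"
      using u by simp
    show "inv\<^bsub>R\<^esub> u \<noteq> u"
      using u ne by (metis Units_r_inv)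
    have "inv\<^bsub>R\<^esub> u \<otimes>\<^bsub>R\<^esub> inv\<^bsub>R\<^esub> u \<noteq> \<one>\<^bsub>R\<^esub>"
      using u ne inv2 by (metis Units_inv_Units Units_inv_closed inv_unique' Units_r_inv)
    then show "inv\<^bsub>R\<^esub> u \<in> Units R - involutive_units R"
      using u by (simp add: involutive_units_def)
  qed (use fin in simp)
  then show "even (card (Units R) - card (involutive_units R))"
    using card_Diff_subset[OF finite_subset[OF sub fin] sub] by simp
qed

end

theory Submission
  imports Defs
begin

text \<open>
  Two units satisfy \<open>u v = v u = 1\<close> exactly when \<open>v\<close> is the inverse of \<open>u\<close>, so the second kind of
  adjacency in \<open>Cl\<^sub>2(R)\<close> sees the units only through the involution \<open>u \<mapsto> u\<^sup>-\<^sup>1\<close>, whose fixed points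
  form \<open>U'(R)\<close>. The shuriken graph carries the same structure on the indices of its copies: its
  second and third edge sets join copy \<open>i\<close> to copy \<open>\<sigma> i\<close>, where the involution \<open>\<sigma>\<close> of
  \<open>{1, \<dots>, n}\<close> fixes \<open>1, \<dots>, t\<close> and reflects \<open>t + 1, \<dots>, n\<close> (\<open>shuriken_arc_iff\<close>). Involutions of
  finite sets of the same size with the same number of fixed points are conjugate, so the units can
  be numbered in such a way that inversion becomes \<open>\<sigma>\<close> (\<open>ex_involution_numbering\<close>).

  The vertices of one copy are the nonzero idempotents, the identity playing the role of the new
  vertex \<open>z\<close>. This is consistent with the first kind of adjacency, \<open>e f = f e = 0\<close>: the identity is
  orthogonal to no nonzero idempotent and a nonzero idempotent is not orthogonal to itself, so
  orthogonality of nonzero idempotents is adjacency in \<open>I(R)\<close>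
  (\<open>orthogonal_iff_idempotent_graph_arc\<close>), just as the first edge set of the shuriken graph avoids
  every copy of \<open>z\<close>.
\<close>

section \<open>Numbering a finite set along an involution\<close>

definition shuriken_partner :: "nat \<Rightarrow> nat \<Rightarrow> nat \<Rightarrow> nat"
  where "shuriken_partner t n i = (if i \<le> t then i else n + t + 1 - i)"

text \<open>
  One orbit \<open>{a, f a}\<close> takes the two ends \<open>t + 1\<close> and \<open>n\<close> of the interval. What remains is a shorter
  interval with the same centre, hence with the same reflection; for this step the bounds
  \<open>t\<close> and \<open>n\<close> have to vary in the induction.
\<close>

lemma ex_reflected_numbering:
  assumes "finite A" and "n = t + card A"
    and "\<And>x. x \<in> A \<Longrightarrow> f x \<in> A" "\<And>x. x \<in> A \<Longrightarrow> f (f x) = x" "\<And>x. x \<in> A \<Longrightarrow> f x \<noteq> x"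
  shows "\<exists>h. bij_betw h A {t + 1..n} \<and> (\<forall>x \<in> A. h (f x) = n + t + 1 - h x)"
  using assms
proof (induction "card A" arbitrary: A t n rule: less_induct)
  case less
  show ?case
  proof (cases "A = {}")
    case True
    then show ?thesis using less.prems(2) by (auto simp: bij_betw_def)
  next
    case False
    then obtain a where a: "a \<in> A" by blast
    let ?B = "A - {a, f a}"
    have sub: "{a, f a} \<subseteq> A" and ne: "f a \<noteq> a"
      using a less.prems(3)[OF a] less.prems(5)[OF a] by auto
    have two: "card {a, f a} = 2"
      using ne by auto
    have card: "card A = card ?B + 2"
      using card_Diff_subset[of "{a, f a}" A] card_mono[OF less.prems(1) sub] two sub by simp
    have closed: "f x \<in> ?B" if "x \<in> ?B" for x
      using that a less.prems(3,4) by (metis DiffD1 DiffD2 DiffI insert_iff singletonD)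
    have "\<exists>h. bij_betw h ?B {(t + 1) + 1..n - 1} \<and>
        (\<forall>x \<in> ?B. h (f x) = (n - 1) + (t + 1) + 1 - h x)"
      by (rule less.hyps) (use card closed less.prems in auto)
    then obtain h where bij: "bij_betw h ?B {t + 2..n - 1}"
      and refl: "\<And>x. x \<in> ?B \<Longrightarrow> h (f x) = n + t + 1 - h x"
      using less.prems(2) card by auto
    let ?k = "h(a := t + 1, f a := n)"
    have len: "t + 2 \<le> n"
      using less.prems(2) card by simp
    have "bij_betw ?k ?B {t + 2..n - 1}"
      by (rule bij_betw_cong[THEN iffD1, OF _ bij]) auto
    moreover have "bij_betw ?k {a, f a} {t + 1, n}"
      using ne len by (auto simp: bij_betw_def inj_on_def)
    ultimately have "bij_betw ?k (?B \<union> {a, f a}) ({t + 2..n - 1} \<union> {t + 1, n})"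
      using len by (intro bij_betw_combine) auto
    moreover have "?B \<union> {a, f a} = A" "{t + 2..n - 1} \<union> {t + 1, n} = {t + 1..n}"
      using sub len by auto
    ultimately have "bij_betw ?k A {t + 1..n}"
      by simp
    moreover have "?k (f x) = n + t + 1 - ?k x" if x: "x \<in> A" for x
    proof (cases "x \<in> ?B")
      case True
      then show ?thesis
        using closed[OF True] refl[OF True] by auto
    next
      case False
      then have "x = a \<or> x = f a"
        using x by simp
      then show ?thesis
        using ne less.prems(4)[OF a] by auto
    qed
    ultimately show ?thesis by blast
  qed
qed

lemma ex_involution_numbering:
  assumes "finite A"
    and "\<And>x. x \<in> A \<Longrightarrow> f x \<in> A" "\<And>x. x \<in> A \<Longrightarrow> f (f x) = x"
  shows "\<exists>g. bij_betw g A {1..card A} \<and>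
    (\<forall>x \<in> A. g (f x) = shuriken_partner (card {x \<in> A. f x = x}) (card A) (g x))"
proof -
  let ?F = "{x \<in> A. f x = x}" and ?M = "{x \<in> A. f x \<noteq> x}"
  let ?t = "card ?F" and ?n = "card A"
  have A: "A = ?F \<union> ?M"
    by auto
  have "card (?F \<union> ?M) = ?t + card ?M"
    using assms(1) by (intro card_Un_disjoint) auto
  then have n: "?n = ?t + card ?M"
    using A by simp
  have fin: "finite ?F" "finite ?M"
    using assms(1) by simp_all
  obtain k where k: "bij_betw k ?F {1..?t}"
    using ex_bij_betw_nat_finite_1[OF fin(1)] bij_betw_inv by blast
  have "\<exists>h. bij_betw h ?M {?t + 1..?n} \<and> (\<forall>x \<in> ?M. h (f x) = ?n + ?t + 1 - h x)"
    by (rule ex_reflected_numbering[OF fin(2) n]) (use assms(2,3) in auto)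
  then obtain h where h: "bij_betw h ?M {?t + 1..?n}"
    and refl: "\<And>x. x \<in> ?M \<Longrightarrow> h (f x) = ?n + ?t + 1 - h x"
    by blast
  let ?g = "\<lambda>x. if f x = x then k x else h x"
  have "bij_betw ?g ?F {1..?t}"
    by (rule bij_betw_cong[THEN iffD1, OF _ k]) auto
  moreover have "bij_betw ?g ?M {?t + 1..?n}"
    by (rule bij_betw_cong[THEN iffD1, OF _ h]) auto
  ultimately have "bij_betw ?g (?F \<union> ?M) ({1..?t} \<union> {?t + 1..?n})"
    by (intro bij_betw_combine) auto
  moreover have "{1..?t} \<union> {?t + 1..?n} = {1..?n}"
    using n by auto
  ultimately have "bij_betw ?g A {1..?n}"
    using A by simp
  moreover have "?g (f x) = shuriken_partner ?t ?n (?g x)" if x: "x \<in> A" for x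
  proof (cases "f x = x")
    case True
    then have "k x \<in> {1..?t}"
      using x by (intro bij_betwE[OF k, rule_format]) simp
    then show ?thesis
      using True by (simp add: shuriken_partner_def)
  next
    case False
    then have M: "x \<in> ?M"
      using x by simp
    then have "h x \<in> {?t + 1..?n}"
      by (rule bij_betwE[OF h, rule_format])
    then show ?thesis
      using False refl[OF M] assms(3)[OF x] by (auto simp: shuriken_partner_def)
  qed
  ultimately show ?thesis by blast
qed

section \<open>Adjacency in the shuriken graph\<close>

lemma parcs_mk_symmetric: "parcs (mk_symmetric (with_proj H)) = parcs H \<union> (parcs H)\<inverse>"
  by (auto simp: mk_symmetric_def)

lemma pverts_shuriken_graph:
  "pverts (shuriken_graph t n G) = insert None (Some ` pverts G) \<times> {1..n}"
  by (simp add: shuriken_graph_def Let_def mk_symmetric_def)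

text \<open>
  The third edge set uses only indices \<open>i\<close> in the first half of \<open>{t + 1, \<dots>, n}\<close>, and the second half
  comes from reversing arcs. Since \<open>n - t\<close> is even, the reflection of this interval has no fixed
  point, so the arcs of the third set are never loops; hence the uniform condition
  \<open>(a, i) \<noteq> (b, j)\<close>.
\<close>

lemma shuriken_arc_iff:
  assumes "pair_graph G" and "t \<le> n" and "even (n - t)"
    and a: "a \<in> insert None (Some ` pverts G)" and b: "b \<in> insert None (Some ` pverts G)"
    and i: "i \<in> {1..n}" and j: "j \<in> {1..n}"
  shows "((a, i), (b, j)) \<in> parcs (shuriken_graph t n G) \<longleftrightarrow>
    (\<exists>u v. a = Some u \<and> b = Some v \<and> (u, v) \<in> parcs G) \<or>
    (a, i) \<noteq> (b, j) \<and> j = shuriken_partner t n i"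
proof -
  interpret G: pair_graph G by fact
  define V where "V = insert None (Some ` pverts G)"
  define X where "X =
    {((Some u, i), (Some v, j)) | u v i j. (u, v) \<in> parcs G \<and> i \<in> {1..n} \<and> j \<in> {1..n}} \<union>
    {((u, i), (v, i)) | u v i. u \<in> V \<and> v \<in> V \<and> u \<noteq> v \<and> i \<in> {1..t}} \<union>
    {((u, i), (v, n + t + 1 - i)) | u v i. u \<in> V \<and> v \<in> V \<and> i \<in> {t + 1..(n + t) div 2}}"
  have parcs: "parcs (shuriken_graph t n G) = X \<union> X\<inverse>"
    by (simp add: shuriken_graph_def Let_def parcs_mk_symmetric X_def V_def)
  have X: "((a, i), (b, j)) \<in> X \<longleftrightarrow>
      (\<exists>u v. a = Some u \<and> b = Some v \<and> (u, v) \<in> parcs G) \<or>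
      a \<noteq> b \<and> i = j \<and> i \<le> t \<or> t < i \<and> i \<le> (n + t) div 2 \<and> j = n + t + 1 - i"
    if "a \<in> V" "b \<in> V" "i \<in> {1..n}" "j \<in> {1..n}" for a b i j
    using that by (auto simp: X_def)
  have V: "a \<in> V" "b \<in> V"
    using a b by (simp_all add: V_def)
  have sym: "(\<exists>u v. b = Some u \<and> a = Some v \<and> (u, v) \<in> parcs G) \<longleftrightarrow>
      (\<exists>u v. a = Some u \<and> b = Some v \<and> (u, v) \<in> parcs G)"
    using G.arcs_symmetric by blast
  obtain m where m: "n = t + 2 * m"
    using assms(2,3) by (metis evenE le_add_diff_inverse)
  have "((a, i), (b, j)) \<in> X \<union> X\<inverse> \<longleftrightarrow>
      ((a, i), (b, j)) \<in> X \<or> ((b, j), (a, i)) \<in> X"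
    by simp
  also have "\<dots> \<longleftrightarrow>
      (\<exists>u v. a = Some u \<and> b = Some v \<and> (u, v) \<in> parcs G) \<or>
      a \<noteq> b \<and> i = j \<and> i \<le> t \<or>
      t < i \<and> i \<le> t + m \<and> j = n + t + 1 - i \<or> t < j \<and> j \<le> t + m \<and> i = n + t + 1 - j"
    unfolding X[OF V i j] X[OF V(2,1) j i] sym using m by auto
  also have "t < i \<and> i \<le> t + m \<and> j = n + t + 1 - i \<or> t < j \<and> j \<le> t + m \<and> i = n + t + 1 - j
      \<longleftrightarrow> t < i \<and> i \<noteq> j \<and> j = n + t + 1 - i"
    using i j m by auto
  also have "a \<noteq> b \<and> i = j \<and> i \<le> t \<or> t < i \<and> i \<noteq> j \<and> j = n + t + 1 - i
      \<longleftrightarrow> (a, i) \<noteq> (b, j) \<and> j = shuriken_partner t n i"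
  proof (cases "i \<le> t")
    case False
    moreover have "i \<noteq> n + t + 1 - i"
      using m by presburger
    ultimately show ?thesis
      by (auto simp: shuriken_partner_def)
  qed (auto simp: shuriken_partner_def)
  finally show ?thesis
    unfolding parcs .
qed

section \<open>Idempotents and units of a ring\<close>

lemma (in ring) orthogonal_iff_idempotent_graph_arc:
  assumes "e \<in> idempotents R - {\<zero>}" and "f \<in> idempotents R - {\<zero>}"
  shows "e \<otimes> f = \<zero> \<and> f \<otimes> e = \<zero> \<longleftrightarrow> (e, f) \<in> parcs (idempotent_graph R)"
  using assms by (auto simp: idempotent_graph_def idempotents_def)

lemma (in monoid) mutual_inverses_iff:
  assumes "u \<in> Units G" and "v \<in> Units G"
  shows "u \<otimes> v = \<one> \<and> v \<otimes> u = \<one> \<longleftrightarrow> v = inv u"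
  using assms by (metis Units_closed Units_l_inv Units_r_inv inv_unique')

lemma (in ring) involutive_units_eq: "involutive_units R = {u \<in> Units R. inv u = u}"
  unfolding involutive_units_def using mutual_inverses_iff by (metis (lifting))

section \<open>The isomorphism\<close>

theorem theorem6:
  fixes R :: "('a, 'b) ring_scheme"
  assumes "ring R" and "finite (carrier R)" and "\<one>\<^bsub>R\<^esub> \<noteq> \<zero>\<^bsub>R\<^esub>"
  shows "digraph_iso (with_proj (clean_graph2 R))
    (with_proj (shuriken_graph (card (involutive_units R)) (card (Units R)) (idempotent_graph R)))"
proof -
  interpret ring R by fact
  let ?t = "card (involutive_units R)" and ?n = "card (Units R)"
  let ?I = "idempotent_graph R" and ?E = "idempotents R - {\<zero>\<^bsub>R\<^esub>}"
  let ?V = "insert None (Some ` pverts ?I)"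
  note t = card_units_parameters[OF assms(1,2)]
  have I: "pair_graph ?I"
    using assms(2) by (rule pair_graph_idempotent_graph)
  interpret C: pair_graph "clean_graph2 R"
    using assms(2) by (rule pair_graph_clean_graph2)
  interpret S: pair_graph "shuriken_graph ?t ?n ?I"
    using I t(2) by (rule pair_graph_shuriken_graph)
  have "finite (Units R)"
    using assms(2) by (simp add: Units_def)
  then obtain g where g: "bij_betw g (Units R) {1..?n}"
    and g_inv: "\<And>u. u \<in> Units R \<Longrightarrow> g (inv\<^bsub>R\<^esub> u) = shuriken_partner ?t ?n (g u)"
    using ex_involution_numbering[of "Units R" "\<lambda>u. inv\<^bsub>R\<^esub> u"]
    by (auto simp: involutive_units_eq)
  define c where "c e = (if e = \<one>\<^bsub>R\<^esub> then None else Some e)" for e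
  have "c ` ?E = ?V"
    using assms(3) by (auto simp: c_def idempotent_graph_def idempotents_def image_iff)
  then have c: "bij_betw c ?E ?V"
    by (auto simp: bij_betw_def inj_on_def c_def split: if_splits)
  let ?\<phi> = "map_prod c g"
  have \<phi>: "bij_betw ?\<phi> (?E \<times> Units R) (?V \<times> {1..?n})"
    using c g by (rule bij_betw_map_prod)
  have adj: "((e, u), (f, v)) \<in> parcs (clean_graph2 R) \<longleftrightarrow>
      (?\<phi> (e, u), ?\<phi> (f, v)) \<in> parcs (shuriken_graph ?t ?n ?I)"
    if e: "e \<in> ?E" and u: "u \<in> Units R" and f: "f \<in> ?E" and v: "v \<in> Units R" for e u f v
  proof -
    have orth: "e \<otimes>\<^bsub>R\<^esub> f = \<zero>\<^bsub>R\<^esub> \<and> f \<otimes>\<^bsub>R\<^esub> e = \<zero>\<^bsub>R\<^esub> \<longleftrightarrow>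
        (\<exists>x y. c e = Some x \<and> c f = Some y \<and> (x, y) \<in> parcs ?I)"
      unfolding orthogonal_iff_idempotent_graph_arc[OF e f]
      by (auto simp: c_def idempotent_graph_def)
    have "v = inv\<^bsub>R\<^esub> u \<longleftrightarrow> g v = g (inv\<^bsub>R\<^esub> u)"
      using g u v by (auto simp: bij_betw_def inj_on_def)
    then have unit: "u \<otimes>\<^bsub>R\<^esub> v = \<one>\<^bsub>R\<^esub> \<and> v \<otimes>\<^bsub>R\<^esub> u = \<one>\<^bsub>R\<^esub> \<longleftrightarrow> g v = shuriken_partner ?t ?n (g u)"
      using mutual_inverses_iff[OF u v] g_inv[OF u] by simp
    have ne: "(e, u) \<noteq> (f, v) \<longleftrightarrow> (c e, g u) \<noteq> (c f, g v)"
      using c g e u f v by (auto simp: bij_betw_def dest: inj_onD)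
    have "((e, u), (f, v)) \<in> parcs (clean_graph2 R) \<longleftrightarrow> (e, u) \<noteq> (f, v) \<and>
        (e \<otimes>\<^bsub>R\<^esub> f = \<zero>\<^bsub>R\<^esub> \<and> f \<otimes>\<^bsub>R\<^esub> e = \<zero>\<^bsub>R\<^esub> \<or> u \<otimes>\<^bsub>R\<^esub> v = \<one>\<^bsub>R\<^esub> \<and> v \<otimes>\<^bsub>R\<^esub> u = \<one>\<^bsub>R\<^esub>)"
      using e u f v by (auto simp: clean_graph2_def)
    \<comment> \<open>Orthogonal nonzero idempotents are distinct, which absorbs the inequality in the first alternative.\<close>
    also have "\<dots> \<longleftrightarrow> e \<otimes>\<^bsub>R\<^esub> f = \<zero>\<^bsub>R\<^esub> \<and> f \<otimes>\<^bsub>R\<^esub> e = \<zero>\<^bsub>R\<^esub> \<or>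
        (e, u) \<noteq> (f, v) \<and> u \<otimes>\<^bsub>R\<^esub> v = \<one>\<^bsub>R\<^esub> \<and> v \<otimes>\<^bsub>R\<^esub> u = \<one>\<^bsub>R\<^esub>"
      using e by (auto simp: idempotents_def)
    also have "\<dots> \<longleftrightarrow> (\<exists>x y. c e = Some x \<and> c f = Some y \<and> (x, y) \<in> parcs ?I) \<or>
        (c e, g u) \<noteq> (c f, g v) \<and> g v = shuriken_partner ?t ?n (g u)"
      using orth unit ne by blast
    also have "\<dots> \<longleftrightarrow> ((c e, g u), (c f, g v)) \<in> parcs (shuriken_graph ?t ?n ?I)"
      using c g e u f v
      by (intro shuriken_arc_iff[OF I t(2,3), symmetric]) (auto dest!: bij_betwE)
    finally show ?thesis
      by simp
  qed
  have "pverts (clean_graph2 R) = ?E \<times> Units R"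
    by (simp add: clean_graph2_def)
  then show ?thesis
    unfolding digraph_iso_with_proj_iff[OF C.pair_wf_digraph_axioms S.pair_wf_digraph_axioms]
    using \<phi> adj by (intro exI[of _ ?\<phi>]) (auto simp: pverts_shuriken_graph)
qed

end
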